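(* All visual metrics on a given hyperbolic group are Hölder equivalent. That is, if $G$ is a hyperbolic group and $d, d'$ are visual metrics on $G$ (possibly with respect to different finite generating sets, basepoints and parameters), then the identity mappings $(G,d)\to(G,d')$ and $(G,d')\to(G,d)$ both satisfy a Hölder condition.
   Context: All generating sets are finite. For $G = \langle A\rangle$, $\widetilde{A} = A \cup A^{-1}$, and $d_A(g,h)$ is the length of a shortest path from $g$ to $h$ in the Cayley graph $\Gamma_A(G)$ (vertex set $G$, edges $g \to ga$ for $a \in \widetilde{A}$). $G$ is hyperbolic if the geometric realization of $\Gamma_A(G)$ (edges of length 1) is $\delta$-hyperbolic for some $\delta \ge 0$ (every side of every geodesic triangle lies in the closed $\delta$-neighbourhood of the union of the other two sides); this does not depend on $A$. Gromov product: $(g|h)_p^A = \frac12(d_A(p,g)+d_A(p,h)-d_A(g,h))$ for $g,h,p\in G$. Let $\rho^A_{p,\gamma}(g,h) = e^{-\gamma (g|h)_p^A}$ if $g \ne h$ and $0$ otherwise. For $p \in G$, $\gamma>0$, $T\ge 1$, $V^A(p,\gamma,T)$ is the set of all metrics $d$ on $G$ with $\frac1T\rho^A_{p,\gamma}(g,h) \le d(g,h) \le T\rho^A_{p,\gamma}(g,h)$ for all distinct $g,h\in G$. A visual metric on $G$ is a metric belonging to some $V^A(p,\gamma,T)$, with $A$ a finite generating set of $G$. A map $\varphi:(X,d)\to(X',d')$ satisfies a Hölder condition if there are $r>0$ and $K>0$ with $d'(x\varphi,y\varphi)\le K\,d(x,y)^r$ for all $x,y\in X$. *)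

theory Defs
  imports "HOL-Algebra.Generated_Groups" "HOL-Analysis.Abstract_Metric_Spaces"
begin

section \<open>Geometric realization of a graph\<close>

text \<open>
  An undirected graph with vertex set \<open>V\<close> is given by a symmetric relation \<open>E\<close> on \<open>V\<close>; loops
  are allowed. The pairs \<open>(u, v)\<close> and \<open>(v, u)\<close> are the two orientations of a single geometric
  edge \<open>{u, v}\<close> (of the form \<open>{u}\<close> if it is a loop).
\<close>

definition path_dist :: "('v \<times> 'v) set \<Rightarrow> 'v \<Rightarrow> 'v \<Rightarrow> nat" where
  "path_dist E u v = (LEAST n. (u, v) \<in> E ^^ n)"

definition geom_edges :: "('v \<times> 'v) set \<Rightarrow> 'v set set" where
  "geom_edges E = {{u, v} | u v. (u, v) \<in> E}"

text \<open>An arbitrary orientation of each edge, used only to parametrize it by the unit interval.\<close>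

definition edge_start :: "'v set \<Rightarrow> 'v" where
  "edge_start e = (SOME u. u \<in> e)"

definition edge_end :: "'v set \<Rightarrow> 'v" where
  "edge_end e = (SOME v. e = {edge_start e, v})"

text \<open>
  \<open>Inner e t\<close> is the point of the open edge \<open>e\<close> at distance \<open>t\<close> (\<open>0 < t < 1\<close>), along the edge,
  from its start.
\<close>

datatype 'v gpoint = Vertex 'v | Inner "'v set" real

definition realization :: "'v set \<Rightarrow> ('v \<times> 'v) set \<Rightarrow> 'v gpoint set" where
  "realization V E = Vertex ` V \<union> {Inner e t | e t. e \<in> geom_edges E \<and> 0 < t \<and> t < 1}"

text \<open>The ways of reaching a vertex from a point inside its closed edge, with their lengths.\<close>

fun exits :: "'v gpoint \<Rightarrow> ('v \<times> real) set" where
  "exits (Vertex u) = {(u, 0)}"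
| "exits (Inner e t) = {(edge_start e, t), (edge_end e, 1 - t)}"

text \<open>
  The length metric in which every edge has length 1: a shortest path between two points either
  passes through vertices or stays inside one open edge.
\<close>

definition realization_dist :: "('v \<times> 'v) set \<Rightarrow> 'v gpoint \<Rightarrow> 'v gpoint \<Rightarrow> real" where
  "realization_dist E x y =
     Min ({s + real (path_dist E u v) + t | u s v t. (u, s) \<in> exits x \<and> (v, t) \<in> exits y}
        \<union> {\<bar>s - t\<bar> | e s t. x = Inner e s \<and> y = Inner e t})"

section \<open>Hyperbolicity\<close>

text \<open>A geodesic from \<open>x\<close> to \<open>y\<close>, regarded as a subset of the space.\<close>

definition geodesic_segment ::
  "'a set \<Rightarrow> ('a \<Rightarrow> 'a \<Rightarrow> real) \<Rightarrow> 'a \<Rightarrow> 'a \<Rightarrow> 'a set \<Rightarrow> bool" where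
  "geodesic_segment X d x y S \<longleftrightarrow>
     (\<exists>L c. 0 \<le> L \<and> c 0 = x \<and> c L = y \<and> S = c ` {0..L} \<and> S \<subseteq> X \<and>
        (\<forall>s\<in>{0..L}. \<forall>t\<in>{0..L}. d (c s) (c t) = \<bar>s - t\<bar>))"

text \<open>
  For a geodesic segment \<open>S\<close> (or a union of two), which is compact, the set below is the closed
  \<open>\<delta>\<close>-neighbourhood: the distance to \<open>S\<close> is attained.
\<close>

definition closed_nbhd :: "'a set \<Rightarrow> ('a \<Rightarrow> 'a \<Rightarrow> real) \<Rightarrow> real \<Rightarrow> 'a set \<Rightarrow> 'a set" where
  "closed_nbhd X d \<delta> S = {x \<in> X. \<exists>y\<in>S. d x y \<le> \<delta>}"

definition delta_hyperbolic :: "'a set \<Rightarrow> ('a \<Rightarrow> 'a \<Rightarrow> real) \<Rightarrow> real \<Rightarrow> bool" where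
  "delta_hyperbolic X d \<delta> \<longleftrightarrow>
     (\<forall>x y z S1 S2 S3.
        geodesic_segment X d x y S1 \<and> geodesic_segment X d y z S2 \<and> geodesic_segment X d z x S3 \<longrightarrow>
        S1 \<subseteq> closed_nbhd X d \<delta> (S2 \<union> S3) \<and>
        S2 \<subseteq> closed_nbhd X d \<delta> (S1 \<union> S3) \<and>
        S3 \<subseteq> closed_nbhd X d \<delta> (S1 \<union> S2))"

section \<open>Cayley graphs and hyperbolic groups\<close>

definition finite_generating_set :: "('a, 'b) monoid_scheme \<Rightarrow> 'a set \<Rightarrow> bool" where
  "finite_generating_set G A \<longleftrightarrow> finite A \<and> A \<subseteq> carrier G \<and> generate G A = carrier G"

definition sym_closure :: "('a, 'b) monoid_scheme \<Rightarrow> 'a set \<Rightarrow> 'a set" where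
  "sym_closure G A = A \<union> m_inv G ` A"

definition cayley_edges :: "('a, 'b) monoid_scheme \<Rightarrow> 'a set \<Rightarrow> ('a \<times> 'a) set" where
  "cayley_edges G A = {(g, g \<otimes>\<^bsub>G\<^esub> a) | g a. g \<in> carrier G \<and> a \<in> sym_closure G A}"

definition cayley_dist :: "('a, 'b) monoid_scheme \<Rightarrow> 'a set \<Rightarrow> 'a \<Rightarrow> 'a \<Rightarrow> real" where
  "cayley_dist G A g h = real (path_dist (cayley_edges G A) g h)"

text \<open>
  Hyperbolicity of the Cayley graph does not depend on the finite generating set; it is required
  for one of them.
\<close>

definition hyperbolic_group :: "('a, 'b) monoid_scheme \<Rightarrow> bool" where
  "hyperbolic_group G \<longleftrightarrow> group G \<and>
     (\<exists>A \<delta>. finite_generating_set G A \<and> 0 \<le> \<delta> \<and>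
        delta_hyperbolic (realization (carrier G) (cayley_edges G A))
          (realization_dist (cayley_edges G A)) \<delta>)"

section \<open>Visual metrics\<close>

definition gromov_product ::
  "('a, 'b) monoid_scheme \<Rightarrow> 'a set \<Rightarrow> 'a \<Rightarrow> 'a \<Rightarrow> 'a \<Rightarrow> real" where
  "gromov_product G A p g h =
     (cayley_dist G A p g + cayley_dist G A p h - cayley_dist G A g h) / 2"

definition visual_rho ::
  "('a, 'b) monoid_scheme \<Rightarrow> 'a set \<Rightarrow> 'a \<Rightarrow> real \<Rightarrow> 'a \<Rightarrow> 'a \<Rightarrow> real" where
  "visual_rho G A p \<gamma> g h = (if g \<noteq> h then exp (- \<gamma> * gromov_product G A p g h) else 0)"

text \<open>
  \<^locale>\<open>Metric_space\<close> also asks for nonnegativity and symmetry off the carrier; every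
  metric on the carrier extends to such a function, and nothing below depends on the extension.
\<close>

definition visual_metrics ::
  "('a, 'b) monoid_scheme \<Rightarrow> 'a set \<Rightarrow> 'a \<Rightarrow> real \<Rightarrow> real \<Rightarrow> ('a \<Rightarrow> 'a \<Rightarrow> real) set" where
  "visual_metrics G A p \<gamma> T =
     {d. Metric_space (carrier G) d \<and>
         (\<forall>g\<in>carrier G. \<forall>h\<in>carrier G. g \<noteq> h \<longrightarrow>
            1 / T * visual_rho G A p \<gamma> g h \<le> d g h \<and> d g h \<le> T * visual_rho G A p \<gamma> g h)}"

definition visual_metric :: "('a, 'b) monoid_scheme \<Rightarrow> ('a \<Rightarrow> 'a \<Rightarrow> real) \<Rightarrow> bool" where
  "visual_metric G d \<longleftrightarrow>
     (\<exists>A p \<gamma> T. finite_generating_set G A \<and> p \<in> carrier G \<and> \<gamma> > 0 \<and> T \<ge> 1 \<and>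
        d \<in> visual_metrics G A p \<gamma> T)"

definition hoelder_condition ::
  "'a set \<Rightarrow> ('a \<Rightarrow> 'a \<Rightarrow> real) \<Rightarrow> 'b set \<Rightarrow> ('b \<Rightarrow> 'b \<Rightarrow> real) \<Rightarrow> ('a \<Rightarrow> 'b) \<Rightarrow> bool" where
  "hoelder_condition X d X' d' \<phi> \<longleftrightarrow>
     \<phi> \<in> X \<rightarrow> X' \<and>
     (\<exists>r>0. \<exists>K>0. \<forall>x\<in>X. \<forall>y\<in>X. d' (\<phi> x) (\<phi> y) \<le> K * d x y powr r)"

end

theory Submission
  imports Defs "HOL-Real_Asymp.Real_Asymp"
begin

text \<open>
  Let \<open>S\<close> be a generating set whose Cayley graph has thin triangles. A triangle \<open>p, g, h\<close> of
  \<open>S\<close>-geodesics has a center \<open>x\<close>, a vertex within bounded distance of all three sides. For any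
  other finite generating set \<open>A\<close>, the \<open>A\<close>-geodesics are quasi-geodesics for \<open>S\<close>, so \<open>S\<close>-geodesics
  stay within bounded distance of them (only this half of the Morse lemma is needed). Hence \<open>x\<close>
  lies close to the \<open>A\<close>-geodesics between \<open>p\<close>, \<open>g\<close> and \<open>h\<close> as well, which forces the
  \<open>A\<close>-Gromov product of \<open>g\<close> and \<open>h\<close> at \<open>p\<close> to equal the \<open>A\<close>-distance from \<open>p\<close> to \<open>x\<close> up to a
  constant. Since \<open>x\<close> does not depend on \<open>A\<close>, the Gromov products for two generating sets bound
  each other linearly, and exponentiating gives the Hoelder conditions.
\<close>

section \<open>Geodesics in connected graphs\<close>

text \<open>In a graph metric this means that \<open>v\<close> lies on some geodesic from
  \<open>x\<close> to \<open>y\<close>. Using it as a relation avoids choosing geodesics in the thin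
  triangle arguments.\<close>

definition btw :: "('a \<Rightarrow> 'a \<Rightarrow> nat) \<Rightarrow> 'a \<Rightarrow> 'a \<Rightarrow> 'a \<Rightarrow> bool" where
  "btw d x y v \<longleftrightarrow> d x v + d v y = d x y"

locale connected_graph =
  fixes V :: "'v set" and E :: "('v \<times> 'v) set"
  assumes edges_sub: "E \<subseteq> V \<times> V"
    and edges_sym: "sym E"
    and conn: "\<And>u v. u \<in> V \<Longrightarrow> v \<in> V \<Longrightarrow> \<exists>n. (u, v) \<in> E ^^ n"
begin

abbreviation pd :: "'v \<Rightarrow> 'v \<Rightarrow> nat" where
  "pd \<equiv> path_dist E"

lemma pd_le: "(u, v) \<in> E ^^ n \<Longrightarrow> pd u v \<le> n"
  unfolding path_dist_def by (rule Least_le)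

lemma pd_path: "u \<in> V \<Longrightarrow> v \<in> V \<Longrightarrow> (u, v) \<in> E ^^ pd u v"
  unfolding path_dist_def by (rule LeastI_ex) (rule conn)

lemma pd_refl [simp]: "pd u u = 0"
  using pd_le[of u u 0] by simp

lemma pd_zero_iff: "u \<in> V \<Longrightarrow> v \<in> V \<Longrightarrow> pd u v = 0 \<longleftrightarrow> u = v"
  using pd_path[of u v] by auto

lemma relpow_sym: "(u, v) \<in> E ^^ n \<Longrightarrow> (v, u) \<in> E ^^ n"
proof (induction n arbitrary: v)
  case (Suc n)
  then obtain x where x: "(u, x) \<in> E ^^ n" "(x, v) \<in> E"
    by auto
  then have "(v, x) \<in> E" "(x, u) \<in> E ^^ n"
    using Suc.IH edges_sym by (auto dest: symD)
  then show ?case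
    by (rule relpow_Suc_I2)
qed simp

lemma pd_commute: "u \<in> V \<Longrightarrow> v \<in> V \<Longrightarrow> pd u v = pd v u"
  by (meson antisym pd_le pd_path relpow_sym)

lemma pd_triangle: "u \<in> V \<Longrightarrow> v \<in> V \<Longrightarrow> x \<in> V \<Longrightarrow> pd u x \<le> pd u v + pd v x"
  by (rule pd_le) (auto simp: relpow_add intro!: pd_path relcompI)

section \<open>Geodesic edge paths\<close>

definition edge_geodesic :: "(nat \<Rightarrow> 'v) \<Rightarrow> nat \<Rightarrow> bool" where
  "edge_geodesic w n \<longleftrightarrow>
     (\<forall>i\<le>n. w i \<in> V) \<and> (\<forall>i<n. (w i, w (Suc i)) \<in> E) \<and> pd (w 0) (w n) = n"

lemma edge_path_relpow:
  assumes "\<And>i. i < n \<Longrightarrow> (w i, w (Suc i)) \<in> E" "i \<le> j" "j \<le> n"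
  shows "(w i, w j) \<in> E ^^ (j - i)"
  unfolding relpow_fun_conv
  by (rule exI[of _ "\<lambda>k. w (i + k)"]) (use assms in auto)

text \<open>No subpath can be shortened: otherwise the triangle inequality through
  \<open>w i\<close> and \<open>w j\<close> would bring the endpoints closer than
  \<open>n\<close>.\<close>

lemma edge_geodesic_dist_le:
  assumes "edge_geodesic w n" "i \<le> j" "j \<le> n"
  shows "pd (w i) (w j) = j - i"
proof (rule antisym)
  have V: "w 0 \<in> V" "w i \<in> V" "w j \<in> V" "w n \<in> V"
    using assms by (auto simp: edge_geodesic_def)
  have le: "pd (w a) (w b) \<le> b - a" if "a \<le> b" "b \<le> n" for a b
    using assms(1) that unfolding edge_geodesic_def by (intro pd_le edge_path_relpow) auto
  show "pd (w i) (w j) \<le> j - i"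
    using assms le by blast
  have "n \<le> pd (w 0) (w i) + pd (w i) (w j) + pd (w j) (w n)"
    using pd_triangle[of "w 0" "w i" "w n"] pd_triangle[of "w i" "w j" "w n"] V assms(1)
    by (auto simp: edge_geodesic_def)
  then show "j - i \<le> pd (w i) (w j)"
    using le[of 0 i] le[of j n] assms(2,3) by linarith
qed

lemma edge_geodesic_dist:
  assumes "edge_geodesic w n" "i \<le> n" "j \<le> n"
  shows "real (pd (w i) (w j)) = \<bar>real i - real j\<bar>"
proof (cases "i \<le> j")
  case True
  then show ?thesis
    using edge_geodesic_dist_le[of w n i j] assms by simp
next
  case False
  moreover have "pd (w i) (w j) = pd (w j) (w i)"
    using assms by (intro pd_commute) (auto simp: edge_geodesic_def)
  ultimately show ?thesis
    using edge_geodesic_dist_le[of w n j i] assms by simp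
qed

lemma edge_geodesic_exists:
  assumes "u \<in> V" "v \<in> V"
  obtains w where "edge_geodesic w (pd u v)" "w 0 = u" "w (pd u v) = v"
proof -
  obtain w where w: "w 0 = u" "w (pd u v) = v" "\<And>i. i < pd u v \<Longrightarrow> (w i, w (Suc i)) \<in> E"
    using pd_path[OF assms] unfolding relpow_fun_conv by blast
  have "w i \<in> V" if "i \<le> pd u v" for i
    using that w(3)[of i] edges_sub w(2) assms(2) by (cases "i = pd u v") auto
  then show thesis
    using w by (intro that[of w]) (auto simp: edge_geodesic_def)
qed

text \<open>Two geodesics that meet at \<open>v\<close> concatenate to a geodesic because their
  lengths add up to the distance. Hyperbolicity speaks of given geodesics, so a side through the
  prescribed vertex has to be built.\<close>

lemma edge_geodesic_through:
  assumes V: "x \<in> V" "y \<in> V" "v \<in> V" and "btw pd x y v"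
  obtains w where "edge_geodesic w (pd x y)" "w 0 = x" "w (pd x y) = y" "w (pd x v) = v"
proof -
  obtain w1 where w1: "edge_geodesic w1 (pd x v)" "w1 0 = x" "w1 (pd x v) = v"
    using edge_geodesic_exists V by metis
  obtain w2 where w2: "edge_geodesic w2 (pd v y)" "w2 0 = v" "w2 (pd v y) = y"
    using edge_geodesic_exists V by metis
  define w where "w i = (if i \<le> pd x v then w1 i else w2 (i - pd x v))" for i
  have n: "pd x y = pd x v + pd v y"
    using assms(4) by (simp add: btw_def)
  have w0: "w 0 = x" "w (pd x v) = v"
    using w1 by (auto simp: w_def)
  have wy: "w (pd x y) = y"
  proof (cases "pd v y = 0")
    case True
    then show ?thesis
      using w1(3) w2(2,3) n by (simp add: w_def)
  next
    case False
    then show ?thesis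
      using w2(3) n by (simp add: w_def)
  qed
  have "w i \<in> V" if "i \<le> pd x y" for i
    using that w1(1) w2(1) n by (simp add: w_def edge_geodesic_def)
  moreover have "(w i, w (Suc i)) \<in> E" if "i < pd x y" for i
  proof (cases "i < pd x v")
    case True
    then show ?thesis
      using w1(1) unfolding w_def edge_geodesic_def by auto
  next
    case False
    \<comment> \<open>At \<open>i = pd x v\<close> the definition still selects \<open>w1\<close>,
      but both pieces take the value \<open>v\<close> there.\<close>
    then have "w i = w2 (i - pd x v)" "w (Suc i) = w2 (Suc (i - pd x v))"
      using w1(3) w2(2) by (auto simp: w_def Suc_diff_le not_less le_Suc_eq)
    then show ?thesis
      using w2(1) that False n by (simp add: edge_geodesic_def)
  qed
  ultimately have "edge_geodesic w (pd x y)"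
    using w0 wy by (simp add: edge_geodesic_def)
  then show thesis
    using that w0 wy by blast
qed

lemma edge_geodesic_btw:
  assumes "edge_geodesic w n" "i \<le> n"
  shows "btw pd (w 0) (w n) (w i)"
  using edge_geodesic_dist_le[OF assms(1), of 0 i] edge_geodesic_dist_le[OF assms(1), of i n]
    edge_geodesic_dist_le[OF assms(1), of 0 n] assms(2)
  by (simp add: btw_def)

section \<open>From the geometric realization to the vertices\<close>

text \<open>This is the unit speed parametrization of an edge path. Inner points are addressed from
  \<open>edge_start\<close>, an arbitrary choice, so the parameter is reversed whenever the path
  runs against that orientation.\<close>

definition realize :: "(nat \<Rightarrow> 'v) \<Rightarrow> real \<Rightarrow> 'v gpoint" where
  "realize w s =
     (let n = nat \<lfloor>s\<rfloor> in
      if s = real n then Vertex (w n)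
      else Inner {w n, w (Suc n)}
             (if edge_start {w n, w (Suc n)} = w n then s - real n else 1 - (s - real n)))"

lemma edge_start_cases: "edge_start {u, v} = u \<or> edge_start {u, v} = v"
proof -
  have "edge_start {u, v} \<in> {u, v}"
    unfolding edge_start_def by (rule someI[of _ u]) simp
  then show ?thesis
    by simp
qed

lemma edge_end_eq:
  assumes "u \<noteq> v"
  shows "edge_end {u, v} = (if edge_start {u, v} = u then v else u)"
proof -
  have "{u, v} = {edge_start {u, v}, edge_end {u, v}}"
    unfolding edge_end_def
    by (rule someI_ex) (use edge_start_cases[of u v] in auto)
  then show ?thesis
    using assms edge_start_cases[of u v] by (auto simp: doubleton_eq_iff)
qed

lemma edge_geodesic_inj:
  assumes "edge_geodesic w n" "i \<le> n" "j \<le> n" "w i = w j"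
  shows "i = j"
  using edge_geodesic_dist[OF assms(1-3)] assms(4) by simp

lemma realize_int [simp]: "realize w (real n) = Vertex (w n)"
  by (simp add: realize_def)

lemma nonint_floor:
  assumes "0 \<le> s" "s \<le> real n" "s \<noteq> real (nat \<lfloor>s\<rfloor>)"
  shows "real (nat \<lfloor>s\<rfloor>) < s" "s < real (nat \<lfloor>s\<rfloor>) + 1" "Suc (nat \<lfloor>s\<rfloor>) \<le> n"
proof -
  have eq: "real (nat \<lfloor>s\<rfloor>) = of_int \<lfloor>s\<rfloor>"
    using assms(1) by simp
  show 1: "real (nat \<lfloor>s\<rfloor>) < s"
    using assms(3) eq of_int_floor_le[of s] by linarith
  show "s < real (nat \<lfloor>s\<rfloor>) + 1"
    using eq by linarith
  show "Suc (nat \<lfloor>s\<rfloor>) \<le> n"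
    using 1 assms(2) by linarith
qed

text \<open>An inner point exits at the two integer times around \<open>s\<close>, a vertex only at
  its own time. In both cases these are the integers at distance less than 1 from \<open>s\<close>,
  so orientations and the two kinds of points disappear from the distance computations.\<close>

lemma exits_realize:
  assumes w: "edge_geodesic w n" and s: "0 \<le> s" "s \<le> real n"
  shows "exits (realize w s) = {(w a, \<bar>real a - s\<bar>) | a. a \<le> n \<and> \<bar>real a - s\<bar> < 1}"
proof (cases "s = real (nat \<lfloor>s\<rfloor>)")
  case True
  then obtain m where m: "s = real m"
    by blast
  have "a = m" if "\<bar>real a - real m\<bar> < 1" for a
    using that by linarith
  then show ?thesis
    using m s by auto
next
  case False
  define m where "m = nat \<lfloor>s\<rfloor>"
  have m: "real m < s" "s < real m + 1" "Suc m \<le> n"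
    using nonint_floor[OF s False] by (auto simp: m_def)
  have ne: "w m \<noteq> w (Suc m)"
    using edge_geodesic_inj[OF w, of m "Suc m"] m by auto
  have "a = m \<or> a = Suc m" if "\<bar>real a - s\<bar> < 1" for a
    using that m by linarith
  then have "{(w a, \<bar>real a - s\<bar>) | a. a \<le> n \<and> \<bar>real a - s\<bar> < 1}
      = {(w m, s - real m), (w (Suc m), real m + 1 - s)}"
    using m by (fastforce simp: abs_if)
  moreover have "exits (realize w s) = {(w m, s - real m), (w (Suc m), real m + 1 - s)}"
    using False ne edge_end_eq[OF ne] edge_start_cases[of "w m" "w (Suc m)"]
    by (auto simp: realize_def Let_def m_def[symmetric])
  ultimately show ?thesis
    by simp
qed

lemma finite_exits: "finite (exits x)"
  by (cases x) auto

lemma finite_realization_dist_candidates: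
  "finite ({s + real (pd u v) + t | u s v t. (u, s) \<in> exits x \<and> (v, t) \<in> exits y}
        \<union> {\<bar>s - t\<bar> | e s t. x = Inner e s \<and> y = Inner e t})"
proof -
  have "{s + real (pd u v) + t | u s v t. (u, s) \<in> exits x \<and> (v, t) \<in> exits y}
     = (\<lambda>((u, s), (v, t)). s + real (pd u v) + t) ` (exits x \<times> exits y)"
    by force
  moreover have "finite {\<bar>s - t\<bar> | e s t. x = Inner e s \<and> y = Inner e t}"
    by (cases x; cases y) auto
  ultimately show ?thesis
    by (simp add: finite_exits finite_imageI)
qed

text \<open>The alternatives mirror the two kinds of candidates in \<open>realization_dist\<close>.
  If an integer separates the two times, passing through integers costs nothing extra; otherwise
  both lie strictly inside the same unit interval.\<close>

lemma route_through_integers: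
  fixes s t :: real
  assumes "0 \<le> s" "s \<le> real n" "0 \<le> t" "t \<le> real n"
  shows "(\<exists>a b. a \<le> n \<and> b \<le> n \<and> \<bar>real a - s\<bar> < 1 \<and> \<bar>real b - t\<bar> < 1 \<and>
            \<bar>real a - s\<bar> + \<bar>real a - real b\<bar> + \<bar>real b - t\<bar> = \<bar>s - t\<bar>) \<or>
         (nat \<lfloor>s\<rfloor> = nat \<lfloor>t\<rfloor> \<and> s \<noteq> real (nat \<lfloor>s\<rfloor>) \<and> t \<noteq> real (nat \<lfloor>t\<rfloor>))"
  using assms
proof (induction s t rule: linorder_wlog)
  case (le s t)
  show ?case
  proof (cases "\<exists>k::nat. s \<le> real k \<and> real k \<le> t")
    case True
    then obtain k :: nat where k: "s \<le> real k" "real k \<le> t"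
      by blast
    \<comment> \<open>These are the first integer from \<open>s\<close> onwards and the last one up
      to \<open>t\<close>, so the route never turns back.\<close>
    define a b where "a = nat \<lceil>s\<rceil>" and "b = nat \<lfloor>t\<rfloor>"
    have a: "real a = of_int \<lceil>s\<rceil>" and b: "real b = of_int \<lfloor>t\<rfloor>"
      using le by (auto simp: a_def b_def)
    have ak: "a \<le> k" "k \<le> b"
      using k by (auto simp: a_def b_def le_nat_floor ceiling_le_iff nat_le_iff)
    have "s \<le> real a" "real a < s + 1" "real b \<le> t" "t < real b + 1"
      unfolding a b by linarith+
    moreover have "real a \<le> real b" "b \<le> n"
      using ak \<open>real b \<le> t\<close> le by linarith+
    ultimately show ?thesis
      by (intro disjI1 exI[of _ a] exI[of _ b]) auto
  next
    case False
    have fs: "real (nat \<lfloor>s\<rfloor>) \<le> s" "s < real (nat \<lfloor>s\<rfloor>) + 1"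
      and ft: "real (nat \<lfloor>t\<rfloor>) \<le> t" "t < real (nat \<lfloor>t\<rfloor>) + 1"
      using le by auto
    have "s \<noteq> real (nat \<lfloor>s\<rfloor>)" "t \<noteq> real (nat \<lfloor>t\<rfloor>)"
      using False le by (metis order_refl)+
    moreover have "\<not> s \<le> real (nat \<lfloor>t\<rfloor>)" "\<not> real (Suc (nat \<lfloor>s\<rfloor>)) \<le> t"
      using False fs(2) ft(1) by (meson less_imp_le of_nat_Suc order_trans, metis less_imp_le of_nat_Suc add.commute)
    then have "real (nat \<lfloor>s\<rfloor>) < real (nat \<lfloor>t\<rfloor>) + 1" "real (nat \<lfloor>t\<rfloor>) < real (nat \<lfloor>s\<rfloor>) + 1"
      using fs ft le by linarith+
    then have "nat \<lfloor>s\<rfloor> = nat \<lfloor>t\<rfloor>"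
      by linarith
    ultimately show ?thesis
      by blast
  qed
next
  case (sym s t)
  have "?case" if "a \<le> n" "b \<le> n" "\<bar>real a - t\<bar> < 1" "\<bar>real b - s\<bar> < 1"
    "\<bar>real a - t\<bar> + \<bar>real a - real b\<bar> + \<bar>real b - s\<bar> = \<bar>t - s\<bar>" for a b
    by (rule disjI1, rule exI[of _ b], rule exI[of _ a]) (use that in \<open>intro conjI; linarith\<close>)
  then show ?case
    using sym by metis
qed

text \<open>The value is itself a candidate by \<open>route_through_integers\<close>. No candidate
  is smaller: a route through vertices is measured by the isometry on integer times, and a route
  inside an edge by the position on that edge.\<close>

lemma realization_dist_realize:
  assumes w: "edge_geodesic w n" and s: "0 \<le> s" "s \<le> real n" and t: "0 \<le> t" "t \<le> real n"
  shows "realization_dist E (realize w s) (realize w t) = \<bar>s - t\<bar>"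
  unfolding realization_dist_def
proof (rule Min_eqI[OF finite_realization_dist_candidates])
  fix r
  assume r: "r \<in> {p + real (pd u v) + q | u p v q.
      (u, p) \<in> exits (realize w s) \<and> (v, q) \<in> exits (realize w t)}
    \<union> {\<bar>p - q\<bar> | e p q. realize w s = Inner e p \<and> realize w t = Inner e q}"
  show "\<bar>s - t\<bar> \<le> r"
  proof (cases "\<exists>e s' t'. realize w s = Inner e s' \<and> realize w t = Inner e t' \<and> r = \<bar>s' - t'\<bar>")
    case True
    then obtain e s' t' where
      e: "realize w s = Inner e s'" "realize w t = Inner e t'" "r = \<bar>s' - t'\<bar>"
      by blast
    define m k where "m = nat \<lfloor>s\<rfloor>" and "k = nat \<lfloor>t\<rfloor>"
    have ne: "s \<noteq> real m" "t \<noteq> real k"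
      using e by (auto simp: realize_def Let_def m_def k_def split: if_splits)
    then have mk: "Suc m \<le> n" "Suc k \<le> n"
      using nonint_floor(3)[OF s] nonint_floor(3)[OF t] by (auto simp: m_def k_def)
    have "{w m, w (Suc m)} = {w k, w (Suc k)}"
      using e ne by (auto simp: realize_def Let_def m_def[symmetric] k_def[symmetric])
    \<comment> \<open>A geodesic crosses an edge only once: by injectivity the reversed matching
      would give both \<open>m = Suc k\<close> and \<open>Suc m = k\<close>.\<close>
    then have "w m = w k \<and> w (Suc m) = w (Suc k) \<or> w m = w (Suc k) \<and> w (Suc m) = w k"
      by (auto simp: doubleton_eq_iff)
    then have "m = k"
      using edge_geodesic_inj[OF w, of m k] edge_geodesic_inj[OF w, of m "Suc k"]
        edge_geodesic_inj[OF w, of "Suc m" k] mk by auto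
    then show ?thesis
      using e ne
      by (auto simp: realize_def Let_def m_def[symmetric] k_def[symmetric] split: if_splits)
  next
    case False
    then obtain a b where ab: "a \<le> n" "b \<le> n"
      "r = \<bar>real a - s\<bar> + real (pd (w a) (w b)) + \<bar>real b - t\<bar>"
      using r unfolding exits_realize[OF w s] exits_realize[OF w t] by auto
    then show ?thesis
      using edge_geodesic_dist[OF w ab(1,2)] by linarith
  qed
next
  have "\<bar>s - t\<bar> \<in> {p + real (pd u v) + q | u p v q.
      (u, p) \<in> exits (realize w s) \<and> (v, q) \<in> exits (realize w t)}"
    if "a \<le> n" "b \<le> n" "\<bar>real a - s\<bar> < 1" "\<bar>real b - t\<bar> < 1"
      "\<bar>real a - s\<bar> + \<bar>real a - real b\<bar> + \<bar>real b - t\<bar> = \<bar>s - t\<bar>" for a b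
    unfolding exits_realize[OF w s] exits_realize[OF w t] mem_Collect_eq
    by (rule exI[of _ "w a"], rule exI[of _ "\<bar>real a - s\<bar>"],
        rule exI[of _ "w b"], rule exI[of _ "\<bar>real b - t\<bar>"])
      (use that edge_geodesic_dist[OF w that(1,2)] in auto)
  moreover have "\<bar>s - t\<bar> \<in> {\<bar>p - q\<bar> | e p q. realize w s = Inner e p \<and> realize w t = Inner e q}"
    if "nat \<lfloor>s\<rfloor> = nat \<lfloor>t\<rfloor>" "s \<noteq> real (nat \<lfloor>s\<rfloor>)" "t \<noteq> real (nat \<lfloor>t\<rfloor>)"
    using that by (auto simp: realize_def Let_def)
  ultimately show "\<bar>s - t\<bar> \<in> {p + real (pd u v) + q | u p v q.
      (u, p) \<in> exits (realize w s) \<and> (v, q) \<in> exits (realize w t)}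
    \<union> {\<bar>p - q\<bar> | e p q. realize w s = Inner e p \<and> realize w t = Inner e q}"
    using route_through_integers[OF s t] by blast
qed

lemma realize_in_realization:
  assumes w: "edge_geodesic w n" and s: "0 \<le> s" "s \<le> real n"
  shows "realize w s \<in> realization V E"
proof (cases "s = real (nat \<lfloor>s\<rfloor>)")
  case True
  then have "nat \<lfloor>s\<rfloor> \<le> n"
    using s by linarith
  then show ?thesis
    using True w by (auto simp: realize_def Let_def realization_def edge_geodesic_def)
next
  case False
  define m where "m = nat \<lfloor>s\<rfloor>"
  have m: "real m < s" "s < real m + 1" "Suc m \<le> n"
    using nonint_floor[OF s False] by (auto simp: m_def)
  have "(w m, w (Suc m)) \<in> E"
    using w m(3) by (auto simp: edge_geodesic_def)
  then have "{w m, w (Suc m)} \<in> geom_edges E"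
    by (auto simp: geom_edges_def)
  then show ?thesis
    using m by (auto simp: realize_def Let_def realization_def m_def[symmetric])
qed

lemma geodesic_segment_realize:
  assumes w: "edge_geodesic w n"
  shows "geodesic_segment (realization V E) (realization_dist E) (Vertex (w 0)) (Vertex (w n))
           (realize w ` {0..real n})"
  unfolding geodesic_segment_def
  using realize_in_realization[OF w] realization_dist_realize[OF w]
    realize_int[of w 0] realize_int[of w n]
  by (intro exI[of _ "real n"] exI[of _ "realize w"]) auto

text \<open>A shortest route from a vertex to \<open>y\<close> enters the edge of \<open>y\<close>
  through a vertex of the path. Cutting off the last piece leaves a route to that vertex, so
  \<delta> does not grow.\<close>

lemma near_realize:
  assumes w: "edge_geodesic w n" and y: "y \<in> realize w ` {0..real n}"
    and le: "realization_dist E (Vertex v) y \<le> \<delta>"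
  obtains i where "i \<le> n" "real (pd v (w i)) \<le> \<delta>"
proof -
  obtain s where s: "0 \<le> s" "s \<le> real n" "y = realize w s"
    using y by auto
  have "realization_dist E (Vertex v) y \<in> {s + real (pd u v') + t | u s v' t.
      (u, s) \<in> exits (Vertex v) \<and> (v', t) \<in> exits y}
    \<union> {\<bar>s - t\<bar> | e s t. Vertex v = Inner e s \<and> y = Inner e t}"
    unfolding realization_dist_def
  proof (rule Min_in[OF finite_realization_dist_candidates])
    obtain q where "q \<in> exits y"
      by (cases y) auto
    then show "{s + real (pd u v') + t | u s v' t. (u, s) \<in> exits (Vertex v) \<and> (v', t) \<in> exits y}
      \<union> {\<bar>s - t\<bar> | e s t. Vertex v = Inner e s \<and> y = Inner e t} \<noteq> {}"
      by (cases q) auto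
  qed
  then obtain a where "a \<le> n" "realization_dist E (Vertex v) y = real (pd v (w a)) + \<bar>real a - s\<bar>"
    using exits_realize[OF w s(1,2)] s(3) by auto
  then show thesis
    using le by (intro that[of a]) auto
qed

lemma vertex_in_realize: "i \<le> n \<Longrightarrow> Vertex (w i) \<in> realize w ` {0..real n}"
  by (rule image_eqI[of _ _ "real i"]) auto

text \<open>Realized edge geodesics are admissible sides of a triangle, and one of them can be
  chosen through \<open>v\<close>. The thin triangle condition then applies to
  \<open>Vertex v\<close>, and \<open>near_realize\<close> replaces the nearby point by a
  vertex.\<close>

lemma thin_vertices:
  assumes hyp: "delta_hyperbolic (realization V E) (realization_dist E) \<delta>"
    and V: "x \<in> V" "y \<in> V" "z \<in> V" "v \<in> V" and v: "btw pd x y v"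
  obtains u where "u \<in> V" "btw pd x z u \<or> btw pd z y u" "real (pd v u) \<le> \<delta>"
proof -
  obtain w1 where w1: "edge_geodesic w1 (pd x y)" "w1 0 = x" "w1 (pd x y) = y" "w1 (pd x v) = v"
    using edge_geodesic_through[OF V(1,2,4) v] .
  obtain w2 where w2: "edge_geodesic w2 (pd y z)" "w2 0 = y" "w2 (pd y z) = z"
    using edge_geodesic_exists[OF V(2,3)] .
  obtain w3 where w3: "edge_geodesic w3 (pd z x)" "w3 0 = z" "w3 (pd z x) = x"
    using edge_geodesic_exists[OF V(3,1)] .
  have "realize w1 ` {0..real (pd x y)} \<subseteq>
    closed_nbhd (realization V E) (realization_dist E) \<delta>
      (realize w2 ` {0..real (pd y z)} \<union> realize w3 ` {0..real (pd z x)})"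
    using hyp geodesic_segment_realize[OF w1(1)] geodesic_segment_realize[OF w2(1)]
      geodesic_segment_realize[OF w3(1)] w1(2,3) w2(2,3) w3(2,3)
    unfolding delta_hyperbolic_def by metis
  moreover have "Vertex v \<in> realize w1 ` {0..real (pd x y)}"
    using vertex_in_realize[of "pd x v" "pd x y" w1] w1(4) v by (simp add: btw_def)
  ultimately have "Vertex v \<in> closed_nbhd (realization V E) (realization_dist E) \<delta>
      (realize w2 ` {0..real (pd y z)} \<union> realize w3 ` {0..real (pd z x)})"
    by (rule subsetD)
  then obtain q where
    q: "q \<in> realize w2 ` {0..real (pd y z)} \<union> realize w3 ` {0..real (pd z x)}"
      "realization_dist E (Vertex v) q \<le> \<delta>"
    unfolding closed_nbhd_def mem_Collect_eq by (elim conjE bexE)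
  from q(1) show thesis
  proof
    assume "q \<in> realize w2 ` {0..real (pd y z)}"
    then obtain i where i: "i \<le> pd y z" "real (pd v (w2 i)) \<le> \<delta>"
      using near_realize[OF w2(1) _ q(2)] by blast
    have "w2 i \<in> V"
      using w2(1) i by (simp add: edge_geodesic_def)
    moreover from this have "btw pd z y (w2 i)"
      using edge_geodesic_btw[OF w2(1) i(1)] w2(2,3) V pd_commute[of z y] pd_commute[of "w2 i" z]
        pd_commute[of "w2 i" y] by (simp add: btw_def)
    ultimately show thesis
      using that i by blast
  next
    assume "q \<in> realize w3 ` {0..real (pd z x)}"
    then obtain i where i: "i \<le> pd z x" "real (pd v (w3 i)) \<le> \<delta>"
      using near_realize[OF w3(1) _ q(2)] by blast
    have "w3 i \<in> V"
      using w3(1) i by (simp add: edge_geodesic_def)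
    moreover from this have "btw pd x z (w3 i)"
      using edge_geodesic_btw[OF w3(1) i(1)] w3(2,3) V pd_commute[of x z] pd_commute[of "w3 i" z]
        pd_commute[of "w3 i" x] by (simp add: btw_def)
    ultimately show thesis
      using that i by blast
  qed
qed

end

section \<open>Quasi-geodesics in thin spaces\<close>

text \<open>Here the Cayley graph is reduced to an integer valued metric with discrete geodesics,
  which is all that the Morse argument and the construction of centers use.\<close>

locale thin_space =
  fixes V :: "'a set" and d :: "'a \<Rightarrow> 'a \<Rightarrow> nat" and \<delta> :: nat
  assumes dist_eq_0: "\<And>x y. x \<in> V \<Longrightarrow> y \<in> V \<Longrightarrow> d x y = 0 \<longleftrightarrow> x = y"
    and sym: "\<And>x y. x \<in> V \<Longrightarrow> y \<in> V \<Longrightarrow> d x y = d y x"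
    and tri: "\<And>x y z. x \<in> V \<Longrightarrow> y \<in> V \<Longrightarrow> z \<in> V \<Longrightarrow> d x z \<le> d x y + d y z"
    and interp: "\<And>x y k. x \<in> V \<Longrightarrow> y \<in> V \<Longrightarrow> k \<le> d x y \<Longrightarrow>
      \<exists>z\<in>V. d x z = k \<and> d z y = d x y - k"
    and thin: "\<And>x y z v. x \<in> V \<Longrightarrow> y \<in> V \<Longrightarrow> z \<in> V \<Longrightarrow> v \<in> V \<Longrightarrow> btw d x y v \<Longrightarrow>
      \<exists>u\<in>V. (btw d x z u \<or> btw d z y u) \<and> d v u \<le> \<delta>"
begin

lemma btw_sym: "x \<in> V \<Longrightarrow> y \<in> V \<Longrightarrow> v \<in> V \<Longrightarrow> btw d x y v \<longleftrightarrow> btw d y x v"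
  by (simp add: btw_def sym add.commute)

text \<open>Bisecting the path of length at most \<open>2 ^ k\<close> costs one use of thinness per level.\<close>

lemma near_path_log:
  assumes "\<And>i. a \<le> i \<Longrightarrow> i \<le> b \<Longrightarrow> w i \<in> V"
    and "\<And>i. a \<le> i \<Longrightarrow> i < b \<Longrightarrow> d (w i) (w (Suc i)) \<le> L"
    and "a \<le> b" "b - a \<le> 2 ^ k" "v \<in> V" "btw d (w a) (w b) v"
  shows "\<exists>i. a \<le> i \<and> i \<le> b \<and> d v (w i) \<le> \<delta> * k + L"
  using assms
proof (induction k arbitrary: a b v)
  case 0
  have V: "w a \<in> V" "w b \<in> V"
    using "0.prems" by auto
  have "d (w a) (w b) \<le> L"
  proof (cases "b = a")
    case False
    then have "b = Suc a"
      using "0.prems"(3,4) by simp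
    then show ?thesis
      using "0.prems"(2)[of a] by simp
  qed (use V dist_eq_0[of "w a" "w a"] in simp)
  then have "d v (w b) \<le> L"
    using "0.prems"(6) by (simp add: btw_def)
  then show ?case
    using "0.prems"(3) by auto
next
  case (Suc k)
  define m where "m = (a + b) div 2"
  have m: "a \<le> m" "m \<le> b" "m - a \<le> 2 ^ k" "b - m \<le> 2 ^ k"
    using Suc.prems(3,4) by (auto simp: m_def)
  have V: "w a \<in> V" "w b \<in> V" "w m \<in> V"
    using Suc.prems(1) m by auto
  obtain u where u: "u \<in> V" "btw d (w a) (w m) u \<or> btw d (w m) (w b) u" "d v u \<le> \<delta>"
    using thin[OF V Suc.prems(5,6)] by blast
  have "\<exists>i. a \<le> i \<and> i \<le> b \<and> d u (w i) \<le> \<delta> * k + L"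
    using u(2)
  proof
    assume "btw d (w a) (w m) u"
    then have "\<exists>i. a \<le> i \<and> i \<le> m \<and> d u (w i) \<le> \<delta> * k + L"
      using Suc.IH[of a m u] Suc.prems(1,2) m u(1) by simp
    then show ?thesis
      using m by (meson order_trans)
  next
    assume "btw d (w m) (w b) u"
    then have "\<exists>i. m \<le> i \<and> i \<le> b \<and> d u (w i) \<le> \<delta> * k + L"
      using Suc.IH[of m b u] Suc.prems(1,2) m u(1) by simp
    then show ?thesis
      using m by (meson order_trans)
  qed
  then obtain i where i: "a \<le> i" "i \<le> b" "d u (w i) \<le> \<delta> * k + L"
    by blast
  moreover have "d v (w i) \<le> d v u + d u (w i)"
    using tri Suc.prems(1,5) u(1) i by blast
  ultimately show ?case
    using u(3) by (intro exI[of _ i]) simp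
qed

section \<open>Geodesics stay close to quasi-geodesics\<close>

text \<open>The points lie on one geodesic in the order \<open>x, y, v, z\<close>, so all triangle
  inequalities among them are tight.\<close>

lemma btw_split:
  assumes V: "x \<in> V" "y \<in> V" "z \<in> V" "v \<in> V" and "btw d x z v" "btw d x v y"
  shows "btw d x z y" "btw d y z v"
  using tri[of x y z] tri[of y v z] assms by (auto simp: btw_def)

text \<open>A quantity bounded by a linear function of its own logarithm is bounded. The logarithm
  is replaced by all \<open>k\<close> with \<open>a * D \<le> 2 ^ k\<close>; the point is that
  \<open>K\<close> does not depend on \<open>D\<close>.\<close>

lemma log_le_linear_bound:
  fixes a b c :: nat
  obtains K where "\<And>D. (\<And>k. a * D \<le> 2 ^ k \<Longrightarrow> D \<le> b + c * k) \<Longrightarrow> D \<le> b + c * K"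
proof -
  have "eventually (\<lambda>k::nat. real a * (real b + real c * (real k + 1)) < 2 ^ k) at_top"
    by real_asymp
  then obtain K where K: "\<And>k. k \<ge> K \<Longrightarrow> real a * (real b + real c * (real k + 1)) < 2 ^ k"
    unfolding eventually_at_top_linorder by blast
  have "D \<le> b + c * K" if D: "\<And>k. a * D \<le> 2 ^ k \<Longrightarrow> D \<le> b + c * k" for D
  proof -
    have "a * D < 2 ^ (K + a * D)"
      by (meson le_add2 less_exp less_le_trans one_le_numeral power_increasing)
    then have ex: "a * D \<le> 2 ^ (K + a * D) \<and> K \<le> K + a * D"
      by simp
    \<comment> \<open>If this least exponent exceeded \<open>K\<close>, its predecessor
      \<open>j\<close> would satisfy \<open>2 ^ j < a * D \<le> a * (b + c * (j + 1))\<close>,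
      against the choice of \<open>K\<close>.\<close>
    define k where "k = (LEAST k. a * D \<le> 2 ^ k \<and> K \<le> k)"
    have k: "a * D \<le> 2 ^ k" "K \<le> k"
      using LeastI[of "\<lambda>k. a * D \<le> 2 ^ k \<and> K \<le> k", OF ex] by (simp_all add: k_def)
    have least: "\<not> (a * D \<le> 2 ^ j \<and> K \<le> j)" if "j < k" for j
      using not_less_Least[OF that[unfolded k_def]] .
    have "k = K"
    proof (rule ccontr)
      assume "k \<noteq> K"
      then obtain j where j: "k = Suc j" "K \<le> j"
        using k(2) by (cases k) auto
      have "real (a * D) < real (a * D)"
      proof -
        have "a * D \<le> a * (b + c * k)"
          using D[OF k(1)] by simp
        then have "real (a * D) \<le> real (a * (b + c * k))"
          by (rule of_nat_mono)
        also have "\<dots> = real a * (real b + real c * (real j + 1))"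
          using j by (simp add: algebra_simps)
        also have "\<dots> < 2 ^ j"
          using K j by blast
        also have "2 ^ j < real (a * D)"
        proof -
          have "2 ^ j < a * D"
            using least[of j] j by auto
          then have "real (2 ^ j) < real (a * D)"
            by (rule of_nat_less_iff[THEN iffD2])
          then show ?thesis
            by simp
        qed
        finally show ?thesis .
      qed
      then show False
        by simp
    qed
    then show ?thesis
      using D[OF k(1)] by simp
  qed
  then show thesis
    using that by blast
qed

text \<open>The point \<open>v\<close> of the geodesic is farthest from the path, at distance
  \<open>D\<close>. Points \<open>y\<close> and \<open>z\<close> on either side of \<open>v\<close>
  are joined to the path by detours of length at most \<open>D\<close>, which stay at distance at
  least \<open>D\<close> from \<open>v\<close>. The stretch of path between them has at most
  \<open>6 * L * D\<close> steps, so thinness and \<open>near_path_log\<close> put some point of the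
  detours or of the path close to \<open>v\<close>.\<close>

lemma farthest_point_bound:
  assumes w: "\<And>i. i \<le> n \<Longrightarrow> w i \<in> V" "\<And>i. i < n \<Longrightarrow> d (w i) (w (Suc i)) \<le> L"
      "\<And>i j. i \<le> j \<Longrightarrow> j \<le> n \<Longrightarrow> j - i \<le> L * d (w i) (w j)"
    and v: "v \<in> V" "btw d (w 0) (w n) v"
    and far: "\<And>i. i \<le> n \<Longrightarrow> D \<le> d v (w i)"
    and near: "\<And>y. y \<in> V \<Longrightarrow> btw d (w 0) (w n) y \<Longrightarrow> \<exists>i\<le>n. d y (w i) \<le> D"
    and k: "6 * L * D \<le> 2 ^ k"
  shows "D \<le> 2 * \<delta> + L + \<delta> * k"
proof -
  have W: "w 0 \<in> V" "w n \<in> V"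
    using w(1) by auto
  \<comment> \<open>Distance \<open>2 * D\<close> keeps a detour of length \<open>D\<close> away
    from \<open>v\<close>. If the geodesic ends earlier, the minimum makes \<open>y\<close> its
    endpoint, which is on the path and needs no detour; likewise for \<open>z\<close>.\<close>
  obtain y where y: "y \<in> V" "d v y = min (2 * D) (d v (w 0))" "d y (w 0) = d v (w 0) - d v y"
    using interp[OF v(1) W(1), of "min (2 * D) (d v (w 0))"] by auto
  obtain z where z: "z \<in> V" "d v z = min (2 * D) (d v (w n))" "d z (w n) = d v (w n) - d v z"
    using interp[OF v(1) W(2), of "min (2 * D) (d v (w n))"] by auto
  have "btw d (w 0) v y"
    using y sym[of "w 0" y] sym[of y v] sym[of v "w 0"] W v by (simp add: btw_def)
  note y1 = btw_split[OF W(1) y(1) W(2) v(1) v(2) this]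
  have "btw d (w n) v z"
    using z sym[of "w n" z] sym[of z v] sym[of v "w n"] W v by (simp add: btw_def)
  note z1 = btw_split[OF W(2) z(1) W(1) v(1) _ this] btw_split[OF W(2) z(1) y(1) v(1) _ this]
  have z2: "btw d (w 0) (w n) z" "btw d y z v"
    using z1(1) z1(4) y1(2) btw_sym W v y z by metis+
  have "\<exists>i\<le>n. d y (w i) \<le> D \<and> (w i = y \<or> d v y = 2 * D)"
  proof (cases "d v y = 2 * D")
    case False
    then have "w 0 = y"
      using y dist_eq_0[OF y(1) W(1)] by simp
    then show ?thesis
      using dist_eq_0[OF y(1) y(1)] by (intro exI[of _ 0]) simp
  qed (use near[OF y(1) y1(1)] in blast)
  then obtain i where i: "i \<le> n" "d y (w i) \<le> D" "w i = y \<or> d v y = 2 * D"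
    by blast
  have "\<exists>i\<le>n. d z (w i) \<le> D \<and> (w i = z \<or> d v z = 2 * D)"
  proof (cases "d v z = 2 * D")
    case False
    then have "w n = z"
      using z dist_eq_0[OF z(1) W(2)] by simp
    then show ?thesis
      using dist_eq_0[OF z(1) z(1)] by (intro exI[of _ n]) simp
  qed (use near[OF z(1) z2(1)] in blast)
  then obtain j where j: "j \<le> n" "d z (w j) \<le> D" "w j = z \<or> d v z = 2 * D"
    by blast
  have Wij: "w i \<in> V" "w j \<in> V"
    using w(1) i j by auto
  \<comment> \<open>On a detour from \<open>x\<close> the distance to \<open>v\<close> is at least
    \<open>2 * D - D\<close>; a trivial detour consists of a path point, where \<open>far\<close>
    applies.\<close>
  have far_end: "D \<le> d v u"
    if u: "u \<in> V" "btw d x (w l) u" and x: "x \<in> V" "l \<le> n" "d x (w l) \<le> D"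
      "w l = x \<or> d v x = 2 * D" for u x l
    using x(4)
  proof
    assume "w l = x"
    then have "u = w l"
      using u x(1) dist_eq_0[of x x] dist_eq_0[of x u] by (simp add: btw_def)
    then show ?thesis
      using far x(2) by simp
  next
    assume "d v x = 2 * D"
    moreover have "d v x \<le> d v u + d x u"
      using tri[OF v(1) u(1) x(1)] sym[OF u(1) x(1)] by simp
    moreover have "d x u \<le> D"
      using u(2) x(3) by (simp add: btw_def)
    ultimately show ?thesis
      by simp
  qed
  have "d (w i) (w j) \<le> d (w i) y + d y v + d v z + d z (w j)"
    using tri[OF Wij(1) y(1) Wij(2)] tri[OF y(1) v(1) Wij(2)] tri[OF v(1) z(1) Wij(2)] by simp
  also have "\<dots> \<le> D + 2 * D + 2 * D + D"
    using sym[OF y(1) Wij(1)] sym[OF y(1) v(1)] y(2) z(2) i(2) j(2) by simp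
  finally have dij: "d (w i) (w j) \<le> 6 * D"
    by simp
  \<comment> \<open>The indices found for \<open>y\<close> and \<open>z\<close> may occur in either
    order along the path.\<close>
  have "max i j - min i j \<le> L * d (w (min i j)) (w (max i j))"
    using w(3) i(1) j(1) by simp
  also have "d (w (min i j)) (w (max i j)) = d (w i) (w j)"
    using sym[OF Wij] by (simp add: min_def max_def)
  also have "L * d (w i) (w j) \<le> L * (6 * D)"
    using dij by simp
  finally have ij: "max i j - min i j \<le> 2 ^ k"
    using k by simp
  \<comment> \<open>The quadrilateral \<open>y, w i, w j, z\<close> is cut along the diagonal from
    \<open>w i\<close> to \<open>z\<close>. The two triangles account for the term
    \<open>2 * \<delta>\<close>.\<close>
  obtain u where u: "u \<in> V" "btw d y (w i) u \<or> btw d (w i) z u" "d v u \<le> \<delta>"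
    using thin[OF y(1) z(1) Wij(1) v(1) z2(2)] by blast
  show ?thesis
    using u(2)
  proof
    assume "btw d y (w i) u"
    then have "D \<le> d v u"
      using far_end u(1) y(1) i by blast
    then show ?thesis
      using u(3) by simp
  next
    assume "btw d (w i) z u"
    then obtain u' where u': "u' \<in> V" "btw d (w i) (w j) u' \<or> btw d (w j) z u'" "d u u' \<le> \<delta>"
      using thin[OF Wij(1) z(1) Wij(2) u(1)] by blast
    have vu': "d v u' \<le> 2 * \<delta>"
      using tri[OF v(1) u(1) u'(1)] u(3) u'(3) by simp
    show ?thesis
      using u'(2)
    proof
      assume "btw d (w j) z u'"
      then have "btw d z (w j) u'"
        using btw_sym z(1) Wij u'(1) by blast
      then have "D \<le> d v u'"
        using far_end u'(1) z(1) j by blast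
      then show ?thesis
        using vu' by simp
    next
      assume "btw d (w i) (w j) u'"
      then have "btw d (w (min i j)) (w (max i j)) u'"
        using btw_sym[OF Wij u'(1)] by (simp add: min_def max_def)
      then have "\<exists>l\<ge>min i j. l \<le> max i j \<and> d u' (w l) \<le> \<delta> * k + L"
        using w(1,2) ij i(1) j(1) u'(1) by (intro near_path_log) auto
      then obtain l where l: "l \<le> max i j" "d u' (w l) \<le> \<delta> * k + L"
        by blast
      then have "l \<le> n"
        using i(1) j(1) by simp
      then have "D \<le> d v (w l)" "w l \<in> V"
        using far w(1) by auto
      then show ?thesis
        using tri[OF v(1) u'(1), of "w l"] vu' l(2) by simp
    qed
  qed
qed

text \<open>Applied at a farthest point of the geodesic, \<open>farthest_point_bound\<close> holds
  for every admissible \<open>k\<close>. Then \<open>log_le_linear_bound\<close> turns it into a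
  bound independent of the path and its length.\<close>

lemma morse:
  obtains C where "\<And>w n v. (\<And>i. i \<le> n \<Longrightarrow> w i \<in> V) \<Longrightarrow>
    (\<And>i. i < n \<Longrightarrow> d (w i) (w (Suc i)) \<le> L) \<Longrightarrow>
    (\<And>i j. i \<le> j \<Longrightarrow> j \<le> n \<Longrightarrow> j - i \<le> L * d (w i) (w j)) \<Longrightarrow>
    v \<in> V \<Longrightarrow> btw d (w 0) (w n) v \<Longrightarrow> \<exists>i\<le>n. d v (w i) \<le> C"
proof -
  obtain K where K: "\<And>D. (\<And>k. 6 * L * D \<le> 2 ^ k \<Longrightarrow> D \<le> (2 * \<delta> + L) + \<delta> * k) \<Longrightarrow>
      D \<le> (2 * \<delta> + L) + \<delta> * K"
    using log_le_linear_bound[of "6 * L" "2 * \<delta> + L" \<delta>] by blast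
  have "\<exists>i\<le>n. d v (w i) \<le> (2 * \<delta> + L) + \<delta> * K"
    if w: "\<And>i. i \<le> n \<Longrightarrow> w i \<in> V" "\<And>i. i < n \<Longrightarrow> d (w i) (w (Suc i)) \<le> L"
        "\<And>i j. i \<le> j \<Longrightarrow> j \<le> n \<Longrightarrow> j - i \<le> L * d (w i) (w j)"
      and v: "v \<in> V" "btw d (w 0) (w n) v" for w n v
  proof -
    define f where "f x = Min ((\<lambda>i. d x (w i)) ` {..n})" for x
    have f_le: "f x \<le> d x (w i)" if "i \<le> n" for x i
      using that by (auto simp: f_def)
    have f_in: "\<exists>i\<le>n. f x = d x (w i)" for x
    proof -
      have "f x \<in> (\<lambda>i. d x (w i)) ` {..n}"
        unfolding f_def by (rule Min_in) auto
      then show ?thesis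
        by auto
    qed
    \<comment> \<open>Since \<open>w n\<close> is on the path, \<open>f\<close> is bounded on the
      geodesic points, so its maximum over them is attained even if there are infinitely
      many.\<close>
    have "\<forall>x. x \<in> V \<and> btw d (w 0) (w n) x \<longrightarrow> f x < Suc (d (w 0) (w n))"
    proof (intro allI impI)
      fix x
      assume x: "x \<in> V \<and> btw d (w 0) (w n) x"
      then have "d x (w n) \<le> d (w 0) (w n)"
        by (simp add: btw_def)
      then show "f x < Suc (d (w 0) (w n))"
        using f_le[of n x] by simp
    qed
    then obtain x where x: "x \<in> V" "btw d (w 0) (w n) x"
      and max: "\<And>y. y \<in> V \<Longrightarrow> btw d (w 0) (w n) y \<Longrightarrow> f y \<le> f x"
      using ex_has_greatest_nat[of "\<lambda>x. x \<in> V \<and> btw d (w 0) (w n) x" v f] v by blast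
    have near: "\<exists>i\<le>n. d y (w i) \<le> f x" if "y \<in> V" "btw d (w 0) (w n) y" for y
      using f_in[of y] max[OF that] by metis
    have "f x \<le> (2 * \<delta> + L) + \<delta> * K"
      by (rule K) (rule farthest_point_bound[OF w x f_le near])
    then show ?thesis
      using near[OF v] by (meson order_trans)
  qed
  then show thesis
    using that by blast
qed

section \<open>Centers of triangles and Gromov products\<close>

text \<open>The center is taken on the side from \<open>g\<close> to \<open>h\<close> itself. The
  extra 1 pays for the step from the last point close to one side to the next point, which is close
  to the other.\<close>

definition center :: "'a \<Rightarrow> 'a \<Rightarrow> 'a \<Rightarrow> 'a \<Rightarrow> bool" where
  "center p g h x \<longleftrightarrow> x \<in> V \<and> btw d g h x \<and>
     (\<exists>a\<in>V. btw d g p a \<and> d x a \<le> \<delta>) \<and> (\<exists>b\<in>V. btw d p h b \<and> d x b \<le> \<delta> + 1)"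

text \<open>
  Along a geodesic from \<open>g\<close> to \<open>h\<close>, the last point that is close to the side from \<open>g\<close> to \<open>p\<close>
  is a center.
\<close>

lemma center_exists:
  assumes V: "p \<in> V" "g \<in> V" "h \<in> V"
  obtains x where "center p g h x"
proof -
  define R where "R x \<longleftrightarrow> x \<in> V \<and> btw d g h x \<and> (\<exists>a\<in>V. btw d g p a \<and> d x a \<le> \<delta>)" for x
  have "R g"
    using V dist_eq_0[of g g] by (auto simp: R_def btw_def intro!: bexI[of _ g])
  moreover have "\<forall>x. R x \<longrightarrow> d g x < Suc (d g h)"
    by (auto simp: R_def btw_def)
  ultimately obtain x where x: "R x" and max: "\<And>y. R y \<Longrightarrow> d g y \<le> d g x"
    using ex_has_greatest_nat[of R g "d g"] by blast
  have xV: "x \<in> V" "btw d g h x"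
    using x by (auto simp: R_def)
  have "\<exists>b\<in>V. btw d p h b \<and> d x b \<le> \<delta> + 1"
  proof (cases "d x h = 0")
    case True
    then show ?thesis
      using V dist_eq_0[of h h] by (intro bexI[of _ h]) (auto simp: btw_def)
  next
    case False
    then obtain x' where x': "x' \<in> V" "d x x' = 1" "d x' h = d x h - 1"
      using interp[OF xV(1) V(3), of 1] by auto
    have "d g h \<le> d g x' + d x' h" "d g x' \<le> d g x + d x x'"
      using tri[OF V(2) x'(1) V(3)] tri[OF V(2) xV(1) x'(1)] by simp_all
    then have gx': "d g x' = d g x + 1" "btw d g h x'"
      using x' False xV(2) by (auto simp: btw_def)
    then have "\<not> R x'"
      using max[of x'] by auto
    then obtain b where b: "b \<in> V" "btw d p h b" "d x' b \<le> \<delta>"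
      using thin[OF V(2,3,1) x'(1) gx'(2)] x'(1) gx'(2) unfolding R_def by blast
    then show ?thesis
      using tri[OF xV(1) x'(1) b(1)] x'(2) by auto
  qed
  then show thesis
    using that x unfolding center_def R_def by blast
qed

text \<open>Geodesics of \<open>e\<close> are quasi-geodesics for \<open>d\<close>, so by
  \<open>morse\<close> a \<open>d\<close>-center lies almost on \<open>e\<close>-geodesics between
  the three corners. In the Gromov product the distances from \<open>x\<close> to \<open>g\<close>
  and \<open>h\<close> then cancel up to a constant, leaving \<open>e p x\<close>.\<close>

lemma gromov_product_center:
  fixes e :: "'a \<Rightarrow> 'a \<Rightarrow> nat"
  assumes e_sym: "\<And>x y. x \<in> V \<Longrightarrow> y \<in> V \<Longrightarrow> e x y = e y x"
    and e_tri: "\<And>x y z. x \<in> V \<Longrightarrow> y \<in> V \<Longrightarrow> z \<in> V \<Longrightarrow> e x z \<le> e x y + e y z"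
    and e_geod: "\<And>x y. x \<in> V \<Longrightarrow> y \<in> V \<Longrightarrow> \<exists>w. w 0 = x \<and> w (e x y) = y \<and>
      (\<forall>i\<le>e x y. w i \<in> V) \<and> (\<forall>i j. i \<le> j \<longrightarrow> j \<le> e x y \<longrightarrow> e (w i) (w j) = j - i)"
    and ed: "\<And>x y. x \<in> V \<Longrightarrow> y \<in> V \<Longrightarrow> e x y \<le> L * d x y"
    and de: "\<And>x y. x \<in> V \<Longrightarrow> y \<in> V \<Longrightarrow> d x y \<le> L * e x y"
  obtains C :: real where "\<And>p g h x. p \<in> V \<Longrightarrow> g \<in> V \<Longrightarrow> h \<in> V \<Longrightarrow> center p g h x \<Longrightarrow>
    \<bar>(real (e p g) + real (e p h) - real (e g h)) / 2 - real (e p x)\<bar> \<le> C"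
proof -
  obtain C0 where C0: "\<And>w n v. (\<And>i. i \<le> n \<Longrightarrow> w i \<in> V) \<Longrightarrow>
    (\<And>i. i < n \<Longrightarrow> d (w i) (w (Suc i)) \<le> L) \<Longrightarrow>
    (\<And>i j. i \<le> j \<Longrightarrow> j \<le> n \<Longrightarrow> j - i \<le> L * d (w i) (w j)) \<Longrightarrow>
    v \<in> V \<Longrightarrow> btw d (w 0) (w n) v \<Longrightarrow> \<exists>i\<le>n. d v (w i) \<le> C0"
    using morse[of L] by blast
  \<comment> \<open>The point \<open>v\<close> is within \<open>L * C0\<close> of an
    \<open>e\<close>-geodesic, and this detour is paid once in each of the two summands.\<close>
  have almost: "e x v + e v y \<le> e x y + 2 * (L * C0)"
    if V: "x \<in> V" "y \<in> V" "v \<in> V" and v: "btw d x y v" for x y v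
  proof -
    obtain w where w: "w 0 = x" "w (e x y) = y" "\<And>i. i \<le> e x y \<Longrightarrow> w i \<in> V"
      and iso: "\<And>i j. i \<le> j \<Longrightarrow> j \<le> e x y \<Longrightarrow> e (w i) (w j) = j - i"
      using e_geod[OF V(1,2)] by blast
    have "\<exists>i\<le>e x y. d v (w i) \<le> C0"
    proof (rule C0)
      show "d (w i) (w (Suc i)) \<le> L" if "i < e x y" for i
        using de[of "w i" "w (Suc i)"] iso[of i "Suc i"] w(3) that by simp
      show "j - i \<le> L * d (w i) (w j)" if "i \<le> j" "j \<le> e x y" for i j
        using ed[of "w i" "w j"] iso[of i j] w(3) that by simp
    qed (use w V v in auto)
    then obtain i where i: "i \<le> e x y" "d v (w i) \<le> C0"
      by blast
    have "e v (w i) \<le> L * d v (w i)"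
      using ed V(3) w(3) i(1) by blast
    also have "\<dots> \<le> L * C0"
      using i(2) by simp
    finally have "e v (w i) \<le> L * C0" .
    moreover have "e x (w i) = i" "e (w i) y = e x y - i"
      using iso[of 0 i] iso[of i "e x y"] w(1,2) i(1) by auto
    moreover have "e x v \<le> e x (w i) + e v (w i)" "e v y \<le> e v (w i) + e (w i) y"
      using e_tri[of x "w i" v] e_tri[of v "w i" y] e_sym[of v "w i"] V w(3)[OF i(1)] by auto
    ultimately show ?thesis
      using i(1) by linarith
  qed
  \<comment> \<open>The second term pays, again twice, for moving from the center to a side of the
    \<open>d\<close>-triangle.\<close>
  define M where "M = 2 * (L * C0) + 2 * (L * (\<delta> + 1))"
  have via: "e x v + e v y \<le> e x y + M"
    if V: "x \<in> V" "y \<in> V" "v \<in> V" "u \<in> V" and u: "btw d x y u" "d v u \<le> \<delta> + 1" for x y v u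
  proof -
    have "e v u \<le> L * d v u"
      using ed V by blast
    also have "\<dots> \<le> L * (\<delta> + 1)"
      using u(2) by (rule mult_le_mono2)
    finally have "e v u \<le> L * (\<delta> + 1)" .
    moreover have "e x v \<le> e x u + e v u" "e v y \<le> e v u + e u y"
      using e_tri[of x u v] e_tri[of v u y] e_sym[of v u] V by auto
    ultimately show ?thesis
      using almost[OF V(1,2,4) u(1)] unfolding M_def by linarith
  qed
  have "\<bar>(real (e p g) + real (e p h) - real (e g h)) / 2 - real (e p x)\<bar> \<le> real M"
    if V: "p \<in> V" "g \<in> V" "h \<in> V" and c: "center p g h x" for p g h x
  proof -
    have x: "x \<in> V" "btw d g h x"
      using c by (auto simp: center_def)
    obtain a where a: "a \<in> V" "btw d g p a" "d x a \<le> \<delta>"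
      using c by (auto simp: center_def)
    obtain b where b: "b \<in> V" "btw d p h b" "d x b \<le> \<delta> + 1"
      using c by (auto simp: center_def)
    have "e g x + e x p \<le> e g p + M"
      using via[OF V(2,1) x(1) a(1,2)] a(3) by simp
    moreover have "e p x + e x h \<le> e p h + M"
      using via[OF V(1,3) x(1) b] .
    moreover have "e g x + e x h \<le> e g h + M"
      using almost[OF V(2,3) x] by (simp add: M_def)
    moreover have "e g h \<le> e g x + e x h" "e p h \<le> e p x + e x h" "e p g \<le> e p x + e x g"
      using e_tri V x(1) by auto
    moreover have "e g x = e x g" "e x p = e p x" "e g p = e p g"
      using e_sym V x(1) by auto
    ultimately show ?thesis
      by (simp add: abs_le_iff field_simps flip: of_nat_add)
  qed
  then show thesis
    using that by blast
qed

end

section \<open>Word metrics\<close>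

context group
begin

lemma sym_closure_sub: "A \<subseteq> carrier G \<Longrightarrow> sym_closure G A \<subseteq> carrier G"
  by (auto simp: sym_closure_def)

lemma sym_closure_inv: "A \<subseteq> carrier G \<Longrightarrow> a \<in> sym_closure G A \<Longrightarrow> inv a \<in> sym_closure G A"
  by (auto simp: sym_closure_def)

text \<open>A word for \<open>h\<close> labels a path from every vertex \<open>g\<close>, as edges
  come from right multiplication. The uniform length is needed later, when each generator of one set
  is replaced by a word in the other.\<close>

lemma word_length_uniform:
  assumes A: "A \<subseteq> carrier G" and h: "h \<in> generate G A"
  shows "\<exists>n. \<forall>g\<in>carrier G. (g, g \<otimes> h) \<in> cayley_edges G A ^^ n"
  using h
proof (induction h rule: generate.induct)
  case one
  show ?case
    by (intro exI[of _ 0]) auto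
next
  case (incl h)
  then show ?case
    by (intro exI[of _ 1]) (auto simp: cayley_edges_def sym_closure_def)
next
  case (inv h)
  then show ?case
    by (intro exI[of _ 1]) (auto simp: cayley_edges_def sym_closure_def)
next
  case (eng h1 h2)
  then obtain m n where
    m: "\<And>g. g \<in> carrier G \<Longrightarrow> (g, g \<otimes> h1) \<in> cayley_edges G A ^^ m" and
    n: "\<And>g. g \<in> carrier G \<Longrightarrow> (g, g \<otimes> h2) \<in> cayley_edges G A ^^ n"
    by blast
  have h: "h1 \<in> carrier G" "h2 \<in> carrier G"
    using eng A generate_in_carrier by auto
  have "(g, g \<otimes> (h1 \<otimes> h2)) \<in> cayley_edges G A ^^ (m + n)" if "g \<in> carrier G" for g
    using m[OF that] n[of "g \<otimes> h1"] that h by (auto simp: relpow_add m_assoc)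
  then show ?case
    by blast
qed

lemma connected_graph_cayley:
  assumes "finite_generating_set G A"
  shows "connected_graph (carrier G) (cayley_edges G A)"
proof
  have A: "A \<subseteq> carrier G" "generate G A = carrier G"
    using assms by (auto simp: finite_generating_set_def)
  note S = sym_closure_sub[OF A(1)]
  show "cayley_edges G A \<subseteq> carrier G \<times> carrier G"
    using S by (auto simp: cayley_edges_def)
  show "sym (cayley_edges G A)"
  proof (rule symI)
    fix x y
    assume "(x, y) \<in> cayley_edges G A"
    then obtain a where a: "x \<in> carrier G" "a \<in> sym_closure G A" "y = x \<otimes> a"
      by (auto simp: cayley_edges_def)
    then have "x = y \<otimes> inv a" "y \<in> carrier G" "inv a \<in> sym_closure G A"
      using S sym_closure_inv[OF A(1)] by (auto simp: m_assoc)
    then show "(y, x) \<in> cayley_edges G A"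
      unfolding cayley_edges_def by blast
  qed
  show "\<exists>n. (u, v) \<in> cayley_edges G A ^^ n" if uv: "u \<in> carrier G" "v \<in> carrier G" for u v
  proof -
    have "inv u \<otimes> v \<in> generate G A"
      using uv A(2) by simp
    then obtain n where "(u, u \<otimes> (inv u \<otimes> v)) \<in> cayley_edges G A ^^ n"
      using word_length_uniform[OF A(1)] uv(1) by blast
    moreover have "u \<otimes> (inv u \<otimes> v) = v"
      using uv m_assoc[of u "inv u" v] by simp
    ultimately show ?thesis
      by metis
  qed
qed

text \<open>Each edge of a \<open>B\<close>-path is replaced by an \<open>A\<close>-path of bounded
  length; finitely many letters give a common bound.\<close>

lemma word_metrics_lipschitz:
  assumes A: "finite_generating_set G A" and B: "finite_generating_set G B"
  obtains L where "\<And>u v. u \<in> carrier G \<Longrightarrow> v \<in> carrier G \<Longrightarrow>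
    path_dist (cayley_edges G A) u v \<le> L * path_dist (cayley_edges G B) u v"
proof -
  interpret A: connected_graph "carrier G" "cayley_edges G A"
    by (rule connected_graph_cayley[OF A])
  interpret B: connected_graph "carrier G" "cayley_edges G B"
    by (rule connected_graph_cayley[OF B])
  have AG: "A \<subseteq> carrier G" "generate G A = carrier G" and BG: "B \<subseteq> carrier G" "finite B"
    using A B by (auto simp: finite_generating_set_def)
  have S: "sym_closure G B \<subseteq> carrier G" "finite (sym_closure G B)"
    using sym_closure_sub[OF BG(1)] BG(2) by (auto simp: sym_closure_def)
  have "\<forall>b\<in>sym_closure G B. \<exists>n. \<forall>g\<in>carrier G. (g, g \<otimes> b) \<in> cayley_edges G A ^^ n"
    using word_length_uniform[OF AG(1)] AG(2) S(1) by blast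
  then obtain N where N: "\<And>b g. b \<in> sym_closure G B \<Longrightarrow> g \<in> carrier G \<Longrightarrow>
      (g, g \<otimes> b) \<in> cayley_edges G A ^^ N b"
    by metis
  \<comment> \<open>Inserting \<open>0\<close> keeps the maximum meaningful when \<open>B\<close> is
    empty, as can happen for the trivial group.\<close>
  define L where "L = Max (insert 0 (N ` sym_closure G B))"
  have step: "A.pd x y \<le> L" if xy: "(x, y) \<in> cayley_edges G B" for x y
  proof -
    obtain b where b: "x \<in> carrier G" "b \<in> sym_closure G B" "y = x \<otimes> b"
      using xy unfolding cayley_edges_def by blast
    then have "A.pd x y \<le> N b"
      using A.pd_le N by blast
    also have "N b \<le> L"
      unfolding L_def using S(2) b(2) by (intro Max_ge) auto
    finally show ?thesis .
  qed
  have path: "A.pd u v \<le> L * n" if "(u, v) \<in> cayley_edges G B ^^ n" "u \<in> carrier G" for u v n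
    using that
  proof (induction n arbitrary: v)
    case (Suc n)
    then obtain x where x: "(u, x) \<in> cayley_edges G B ^^ n" "(x, v) \<in> cayley_edges G B"
      by auto
    moreover have "x \<in> carrier G" "v \<in> carrier G"
      using x(2) B.edges_sub by auto
    ultimately show ?case
      using A.pd_triangle[of u x v] step[OF x(2)] Suc by fastforce
  qed auto
  show thesis
    using that[of L] path B.pd_path by blast
qed

text \<open>Distances between vertices are natural numbers, so the real bound can be rounded
  down.\<close>

lemma thin_space_cayley:
  assumes A: "finite_generating_set G A"
    and hyp: "delta_hyperbolic (realization (carrier G) (cayley_edges G A))
          (realization_dist (cayley_edges G A)) \<delta>"
  shows "thin_space (carrier G) (path_dist (cayley_edges G A)) (nat \<lfloor>\<delta>\<rfloor>)"
proof -
  interpret connected_graph "carrier G" "cayley_edges G A"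
    by (rule connected_graph_cayley[OF A])
  show ?thesis
  proof
    fix x y k
    assume xy: "x \<in> carrier G" "y \<in> carrier G" and k: "k \<le> pd x y"
    obtain w where w: "edge_geodesic w (pd x y)" "w 0 = x" "w (pd x y) = y"
      using edge_geodesic_exists[OF xy] .
    then show "\<exists>z\<in>carrier G. pd x z = k \<and> pd z y = pd x y - k"
      using edge_geodesic_dist_le[OF w(1), of 0 k] edge_geodesic_dist_le[OF w(1), of k "pd x y"] k
      by (intro bexI[of _ "w k"]) (auto simp: edge_geodesic_def)
  next
    fix x y z v
    assume V: "x \<in> carrier G" "y \<in> carrier G" "z \<in> carrier G" "v \<in> carrier G" "btw pd x y v"
    obtain u where "u \<in> carrier G" "btw pd x z u \<or> btw pd z y u" "real (pd v u) \<le> \<delta>"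
      using thin_vertices[OF hyp V] .
    then show "\<exists>u\<in>carrier G. (btw pd x z u \<or> btw pd z y u) \<and> pd v u \<le> nat \<lfloor>\<delta>\<rfloor>"
      using le_nat_floor by blast
  qed (use pd_zero_iff pd_commute pd_triangle in auto)
qed

section \<open>Comparison of Gromov products and visual metrics\<close>

text \<open>The center refers to \<open>S\<close> while the Gromov product refers to
  \<open>A\<close>: one point thus serves all generating sets.\<close>

lemma gromov_product_near_center:
  assumes "thin_space (carrier G) (path_dist (cayley_edges G S)) \<delta>"
    and S: "finite_generating_set G S" and A: "finite_generating_set G A"
  obtains C where "\<And>p g h x. p \<in> carrier G \<Longrightarrow> g \<in> carrier G \<Longrightarrow> h \<in> carrier G \<Longrightarrow>
    thin_space.center (carrier G) (path_dist (cayley_edges G S)) \<delta> p g h x \<Longrightarrow>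
    \<bar>gromov_product G A p g h - cayley_dist G A p x\<bar> \<le> C"
proof -
  interpret thin_space "carrier G" "path_dist (cayley_edges G S)" \<delta>
    by fact
  interpret A: connected_graph "carrier G" "cayley_edges G A"
    by (rule connected_graph_cayley[OF A])
  obtain L1 where L1: "\<And>u v. u \<in> carrier G \<Longrightarrow> v \<in> carrier G \<Longrightarrow>
      A.pd u v \<le> L1 * path_dist (cayley_edges G S) u v"
    using word_metrics_lipschitz[OF A S] by blast
  obtain L2 where L2: "\<And>u v. u \<in> carrier G \<Longrightarrow> v \<in> carrier G \<Longrightarrow>
      path_dist (cayley_edges G S) u v \<le> L2 * A.pd u v"
    using word_metrics_lipschitz[OF S A] by blast
  \<comment> \<open>The sum serves as a common Lipschitz constant in both directions.\<close>
  have L: "L1 * m \<le> (L1 + L2) * m" "L2 * m \<le> (L1 + L2) * m" for m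
    by simp_all
  obtain C where "\<And>p g h x. p \<in> carrier G \<Longrightarrow> g \<in> carrier G \<Longrightarrow> h \<in> carrier G \<Longrightarrow>
      center p g h x \<Longrightarrow>
      \<bar>(real (A.pd p g) + real (A.pd p h) - real (A.pd g h)) / 2 - real (A.pd p x)\<bar> \<le> C"
  proof (rule gromov_product_center[of A.pd "L1 + L2"])
    fix x y
    assume V: "x \<in> carrier G" "y \<in> carrier G"
    obtain w where w: "A.edge_geodesic w (A.pd x y)" "w 0 = x" "w (A.pd x y) = y"
      using A.edge_geodesic_exists[OF V] .
    then show "\<exists>w. w 0 = x \<and> w (A.pd x y) = y \<and> (\<forall>i\<le>A.pd x y. w i \<in> carrier G) \<and>
        (\<forall>i j. i \<le> j \<longrightarrow> j \<le> A.pd x y \<longrightarrow> A.pd (w i) (w j) = j - i)"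
      using A.edge_geodesic_dist_le[OF w(1)]
      by (intro exI[of _ w]) (auto simp: A.edge_geodesic_def)
    show "A.pd x y \<le> (L1 + L2) * path_dist (cayley_edges G S) x y"
      using L1[OF V] L(1) order_trans by blast
    show "path_dist (cayley_edges G S) x y \<le> (L1 + L2) * A.pd x y"
      using L2[OF V] L(2) order_trans by blast
  qed (use A.pd_commute A.pd_triangle in auto)
  then show thesis
    using that unfolding gromov_product_def cayley_dist_def by blast
qed

text \<open>Both products based at \<open>p\<close> are close to distances from \<open>p\<close> to
  the same center, and these are compared by the Lipschitz bound. Changing the basepoint to
  \<open>q\<close> costs only a constant.\<close>

lemma gromov_product_linear_bound:
  assumes "thin_space (carrier G) (path_dist (cayley_edges G S)) \<delta>"
    and S: "finite_generating_set G S" and A: "finite_generating_set G A"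
    and B: "finite_generating_set G B" and pq: "p \<in> carrier G" "q \<in> carrier G"
  obtains L C where "L > 0" "\<And>g h. g \<in> carrier G \<Longrightarrow> h \<in> carrier G \<Longrightarrow>
    gromov_product G A p g h \<le> L * gromov_product G B q g h + C"
proof -
  interpret thin_space "carrier G" "path_dist (cayley_edges G S)" \<delta>
    by fact
  interpret B: connected_graph "carrier G" "cayley_edges G B"
    by (rule connected_graph_cayley[OF B])
  obtain CA where CA: "\<And>p g h x. p \<in> carrier G \<Longrightarrow> g \<in> carrier G \<Longrightarrow> h \<in> carrier G \<Longrightarrow> center p g h x \<Longrightarrow>
      \<bar>gromov_product G A p g h - cayley_dist G A p x\<bar> \<le> CA"
    by (rule gromov_product_near_center[OF assms(1) S A]) (rule that)
  obtain CB where CB: "\<And>p g h x. p \<in> carrier G \<Longrightarrow> g \<in> carrier G \<Longrightarrow> h \<in> carrier G \<Longrightarrow> center p g h x \<Longrightarrow>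
      \<bar>gromov_product G B p g h - cayley_dist G B p x\<bar> \<le> CB"
    by (rule gromov_product_near_center[OF assms(1) S B]) (rule that)
  obtain L where L: "\<And>u v. u \<in> carrier G \<Longrightarrow> v \<in> carrier G \<Longrightarrow>
      path_dist (cayley_edges G A) u v \<le> L * B.pd u v"
    using word_metrics_lipschitz[OF A B] by blast
  \<comment> \<open>Adding 1 makes the factor positive even if \<open>L\<close> is 0; the Hoelder
    exponent will have it in its denominator.\<close>
  define M where "M = real L + 1"
  define D where "D = cayley_dist G B p q"
  have "gromov_product G A p g h \<le> M * gromov_product G B q g h + (CA + M * (CB + D))"
    if gh: "g \<in> carrier G" "h \<in> carrier G" for g h
  proof -
    obtain x where x: "center p g h x"
      using center_exists[OF pq(1) gh] .
    then have xG: "x \<in> carrier G"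
      by (simp add: center_def)
    have base: "gromov_product G B p g h \<le> gromov_product G B q g h + D"
      using B.pd_triangle[OF pq gh(1), THEN of_nat_mono[where 'a = real]]
        B.pd_triangle[OF pq gh(2), THEN of_nat_mono[where 'a = real]]
      unfolding gromov_product_def cayley_dist_def D_def of_nat_add by argo
    have "cayley_dist G A p x \<le> real L * cayley_dist G B p x"
      using L[OF pq(1) xG] unfolding cayley_dist_def by (metis of_nat_mono of_nat_mult)
    also have "\<dots> \<le> M * cayley_dist G B p x"
      by (simp add: M_def cayley_dist_def distrib_right)
    also have "\<dots> \<le> M * (gromov_product G B q g h + D + CB)"
      using CB[OF pq(1) gh x] base by (intro mult_left_mono) (auto simp: M_def)
    finally show ?thesis
      using CA[OF pq(1) gh x] by (simp add: algebra_simps)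
  qed
  moreover have "M > 0"
    by (simp add: M_def)
  ultimately show thesis
    using that by blast
qed

text \<open>The lower visual bound of \<open>d\<close> controls the \<open>A\<close>-product from
  below, the linear bound passes this on to the \<open>B\<close>-product, and the upper visual bound
  of \<open>d'\<close> turns it into an estimate of \<open>d'\<close>.\<close>

lemma hoelder_of_visual:
  assumes thin: "thin_space (carrier G) (path_dist (cayley_edges G S)) \<delta>"
    and S: "finite_generating_set G S"
    and d: "visual_metric G d" and d': "visual_metric G d'"
  shows "hoelder_condition (carrier G) d (carrier G) d' id"
proof -
  obtain A p \<gamma> T where A: "finite_generating_set G A" "p \<in> carrier G" "\<gamma> > 0" "T \<ge> 1"
    "d \<in> visual_metrics G A p \<gamma> T"
    using d by (auto simp: visual_metric_def)
  obtain B q \<beta> U where B: "finite_generating_set G B" "q \<in> carrier G" "\<beta> > 0" "U \<ge> 1"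
    "d' \<in> visual_metrics G B q \<beta> U"
    using d' by (auto simp: visual_metric_def)
  obtain L C where L: "L > 0" "\<And>g h. g \<in> carrier G \<Longrightarrow> h \<in> carrier G \<Longrightarrow>
      gromov_product G A p g h \<le> L * gromov_product G B q g h + C"
    using gromov_product_linear_bound[OF thin S A(1) B(1) A(2) B(2)] by blast
  \<comment> \<open>The exponent satisfies \<open>\<gamma> * r = \<beta> / L\<close>, which turns
    the decay rate of \<open>d\<close> into the one obtained for \<open>d'\<close>; \<open>K\<close>
    collects the additive constant and the two multiplicative ones.\<close>
  define r where "r = \<beta> / (L * \<gamma>)"
  define K where "K = U * exp (\<beta> * C / L) * T powr r"
  have pos: "r > 0" "K > 0"
    using A B L(1) by (auto simp: r_def K_def)
  have "d' x y \<le> K * d x y powr r" if x: "x \<in> carrier G" and y: "y \<in> carrier G" for x y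
  proof (cases "x = y")
    case True
    then show ?thesis
      using B(5) x y pos by (auto simp: visual_metrics_def Metric_space.mdist_zero)
  next
    case False
    define a b where "a = gromov_product G A p x y" and "b = gromov_product G B q x y"
    have "1 / T * exp (- \<gamma> * a) \<le> d x y"
      using A(5) False x y by (auto simp: visual_metrics_def visual_rho_def a_def)
    then have da: "exp (- \<gamma> * a) \<le> T * d x y"
      using A(4) by (simp add: field_simps)
    have "0 \<le> d x y"
      using A(5) Metric_space.nonneg[of "carrier G" d x y] by (simp add: visual_metrics_def)
    have "a \<le> L * b + C"
      using L(2) x y by (simp add: a_def b_def)
    then have ab: "(a - C) / L \<le> b"
      using L(1) by (simp add: field_simps)
    have "d' x y \<le> U * exp (- \<beta> * b)"
      using B(5) False x y by (auto simp: visual_metrics_def visual_rho_def b_def)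
    also have "\<dots> \<le> U * exp (- \<beta> * ((a - C) / L))"
    proof -
      have "\<beta> * ((a - C) / L) \<le> \<beta> * b"
        using ab B(3) by (intro mult_left_mono) auto
      then show ?thesis
        using B(4) by simp
    qed
    also have "- \<beta> * ((a - C) / L) = \<beta> * C / L + (- \<gamma> * a) * r"
      using L(1) A(3) by (simp add: r_def field_simps)
    also have "exp \<dots> = exp (\<beta> * C / L) * exp (- \<gamma> * a) powr r"
      by (simp only: exp_add exp_powr_real)
    also have "U * (exp (\<beta> * C / L) * exp (- \<gamma> * a) powr r)
        \<le> U * (exp (\<beta> * C / L) * (T * d x y) powr r)"
      using B(4) da pos(1) by (intro mult_left_mono powr_mono2) auto
    also have "\<dots> = K * d x y powr r"
      using A(4) \<open>0 \<le> d x y\<close> by (simp add: K_def powr_mult)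
    finally show ?thesis .
  qed
  then show ?thesis
    using pos by (auto simp: hoelder_condition_def)
qed

end

theorem proposition3p6:
  fixes G :: "('a, 'b) monoid_scheme" and d d' :: "'a \<Rightarrow> 'a \<Rightarrow> real"
  assumes "hyperbolic_group G"
    and "visual_metric G d"
    and "visual_metric G d'"
  shows "hoelder_condition (carrier G) d (carrier G) d' id \<and>
         hoelder_condition (carrier G) d' (carrier G) d id"
proof -
  interpret group G
    using assms(1) by (simp add: hyperbolic_group_def)
  obtain S \<delta> where S: "finite_generating_set G S" and hyp:
    "delta_hyperbolic (realization (carrier G) (cayley_edges G S))
       (realization_dist (cayley_edges G S)) \<delta>"
    using assms(1) unfolding hyperbolic_group_def by blast
  \<comment> \<open>The roles of the two metrics are interchangeable, so one lemma gives both
    directions.\<close>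
  show ?thesis
    using thin_space_cayley[OF S hyp] hoelder_of_visual S assms(2,3) by blast
qed

end
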